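(* Let $(X,d)$ be a compact metric space and let $\delta=(\delta_1,\dots,\delta_N)$ be a finite family of functions $\delta_i:X\to X$ satisfying $$\delta_1(X)\cup\delta_2(X)\cup\dots\cup\delta_N(X)=X .$$ If for all $i=1,\dots,N$ and all $x,y\in X$ $$x\neq y\ \Rightarrow\ d(\delta_i(x),\delta_i(y))<d(x,y),$$ then the dynamical system $(X,\delta)$ is minimal.
   Context: A dynamical system $(X,\delta)$ is a metric space $X$ with a finite family $\delta=(\delta_1,\dots,\delta_N)$ of continuous maps $\delta_i:X\to X$. Let $\Phi_\delta$ be the semigroup consisting of the identity map and all finite compositions of the maps $\delta_i$. The orbit-set of $x\in X$ is $OS(x)=\{\sigma(x):\sigma\in\Phi_\delta\}$. The system $(X,\delta)$ is called minimal if $\overline{OS(x)}=X$ for all $x\in X$. *)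

theory Defs
  imports "HOL-Analysis.Analysis"
begin

text \<open>
  A family \<open>(\<delta>\<^sub>1, \<dots>, \<delta>\<^sub>N)\<close> of self-maps of a carrier \<open>X :: 'a set\<close> is given by \<open>\<delta> :: nat \<Rightarrow> 'a \<Rightarrow> 'a\<close>,
  of which only the values \<open>\<delta> i x\<close> with \<open>i \<in> {1..N}\<close> and \<open>x \<in> X\<close> are relevant.
\<close>

definition dynamical_system ::
    "'a set \<Rightarrow> ('a \<Rightarrow> 'a \<Rightarrow> real) \<Rightarrow> nat \<Rightarrow> (nat \<Rightarrow> 'a \<Rightarrow> 'a) \<Rightarrow> bool" where
  "dynamical_system X d N \<delta> \<longleftrightarrow>
     Metric_space X d \<and>
     (\<forall>i\<in>{1..N}. continuous_map (Metric_space.mtopology X d) (Metric_space.mtopology X d) (\<delta> i))"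

inductive_set map_semigroup :: "nat \<Rightarrow> (nat \<Rightarrow> 'a \<Rightarrow> 'a) \<Rightarrow> ('a \<Rightarrow> 'a) set"
  for N :: nat and \<delta> :: "nat \<Rightarrow> 'a \<Rightarrow> 'a" where
  ident: "id \<in> map_semigroup N \<delta>"
| gen: "i \<in> {1..N} \<Longrightarrow> \<delta> i \<in> map_semigroup N \<delta>"
| comp: "\<sigma> \<in> map_semigroup N \<delta> \<Longrightarrow> \<tau> \<in> map_semigroup N \<delta> \<Longrightarrow> \<sigma> \<circ> \<tau> \<in> map_semigroup N \<delta>"

definition orbit_set :: "nat \<Rightarrow> (nat \<Rightarrow> 'a \<Rightarrow> 'a) \<Rightarrow> 'a \<Rightarrow> 'a set" where
  "orbit_set N \<delta> x = {\<sigma> x | \<sigma>. \<sigma> \<in> map_semigroup N \<delta>}"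

definition minimal_system ::
    "'a set \<Rightarrow> ('a \<Rightarrow> 'a \<Rightarrow> real) \<Rightarrow> nat \<Rightarrow> (nat \<Rightarrow> 'a \<Rightarrow> 'a) \<Rightarrow> bool" where
  "minimal_system X d N \<delta> \<longleftrightarrow>
     dynamical_system X d N \<delta> \<and>
     (\<forall>x\<in>X. Metric_space.mtopology X d closure_of orbit_set N \<delta> x = X)"

end

theory Submission
  imports Defs
begin

text \<open>
  The closure \<open>A\<close> of an orbit is a nonempty closed set mapped into itself by every \<open>\<delta>\<^sub>i\<close>.
  By compactness some \<open>y\<close> maximizes the distance to \<open>A\<close>. Write \<open>y = \<delta>\<^sub>i(z)\<close> and let \<open>a \<in> A\<close>
  be a point nearest to \<open>z\<close>. If \<open>z \<noteq> a\<close>, then \<open>y\<close> is at distance less than \<open>d(z,a)\<close> from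
  \<open>\<delta>\<^sub>i(a) \<in> A\<close>, contradicting maximality; so \<open>z = a\<close>, whence \<open>y \<in> A\<close> and \<open>A = X\<close>.
\<close>

lemma (in Metric_space) nonexpansive_imp_continuous_map:
  assumes "Metric_space M' d'" and "f \<in> M \<rightarrow> M'"
    and le: "\<And>x y. x \<in> M \<Longrightarrow> y \<in> M \<Longrightarrow> d' (f x) (f y) \<le> d x y"
  shows "continuous_map mtopology (Metric_space.mtopology M' d') f"
proof -
  have "\<exists>\<delta>>0. \<forall>x. x \<in> M \<and> d a x < \<delta> \<longrightarrow> d' (f a) (f x) < \<epsilon>" if "a \<in> M" "\<epsilon> > 0" for a \<epsilon>
    using le[OF that(1)] that(2) by (meson le_less_trans)
  then show ?thesis
    using assms(2) metric_continuous_map[OF assms(1)] by blast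
qed

text \<open>The form used for real-valued functions such as the distance to a point or to a
  set.\<close>

lemma (in Metric_space) nonexpansive_imp_continuous_map_dist:
  fixes f :: "'a \<Rightarrow> 'b::metric_space"
  assumes "\<And>x y. x \<in> M \<Longrightarrow> y \<in> M \<Longrightarrow> dist (f x) (f y) \<le> d x y"
  shows "continuous_map mtopology euclidean f"
  using nonexpansive_imp_continuous_map[OF Met_TC.Metric_space_axioms, of f] assms by simp

text \<open>By the reverse triangle inequality \<open>d x\<close> is nonexpansive, so it maps
  \<open>A\<close> onto a compact set of reals.\<close>

lemma (in Metric_space) compactin_attains_Min_dist:
  assumes "compactin mtopology A" and "A \<noteq> {}" and "x \<in> M"
  obtains a where "a \<in> A" and "\<And>b. b \<in> A \<Longrightarrow> d x a \<le> d x b"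
proof -
  have "continuous_map mtopology euclideanreal (d x)"
    using mdist_reverse_triangle[OF _ assms(3)] commute assms(3)
    by (intro nonexpansive_imp_continuous_map_dist) (simp add: dist_real_def)
  then have "compact (d x ` A)"
    using assms(1) image_compactin compactin_euclidean_iff by blast
  then show thesis
    using compact_attains_inf[of "d x ` A"] assms(2) that by auto
qed

text \<open>The distance to \<open>A\<close> is nonexpansive, hence continuous on a compact space.
  It is expressed through nearest points instead of an infimum: \<open>a\<close> is nearest to
  \<open>y\<close>, and maximality at \<open>y\<close> says that every \<open>z\<close> has a point
  of \<open>A\<close> within \<open>d y a\<close>.\<close>

lemma (in Metric_space) compact_space_attains_Max_setdist:
  assumes "compact_space mtopology" and "closedin mtopology A" and "A \<noteq> {}"
  obtains y a where "y \<in> M" "a \<in> A" "\<And>b. b \<in> A \<Longrightarrow> d y a \<le> d y b"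
    "\<And>z. z \<in> M \<Longrightarrow> \<exists>c\<in>A. d z c \<le> d y a"
proof -
  have A: "compactin mtopology A" "A \<subseteq> M"
    using assms closedin_compact_space closedin_subset by fastforce+
  have "\<exists>a. a \<in> A \<and> (\<forall>b\<in>A. d x a \<le> d x b)" if "x \<in> M" for x
    using compactin_attains_Min_dist[OF A(1) assms(3) that] by metis
  \<comment> \<open>\<open>p\<close> chooses a nearest point of \<open>A\<close>. It may be
    discontinuous; only \<open>d x (p x)\<close>, the distance from \<open>x\<close> to
    \<open>A\<close>, has to vary continuously.\<close>
  then obtain p where p: "\<And>x. x \<in> M \<Longrightarrow> p x \<in> A"
      "\<And>x b. x \<in> M \<Longrightarrow> b \<in> A \<Longrightarrow> d x (p x) \<le> d x b"
    by metis
  \<comment> \<open>\<open>p y\<close> lies in \<open>A\<close>, so it competes with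
    \<open>p x\<close> for being nearest to \<open>x\<close>.\<close>
  have lip: "d x (p x) \<le> d x y + d y (p y)" if "x \<in> M" "y \<in> M" for x y
    using p(2)[of x "p y"] p(1)[of y] triangle[of x y "p y"] A(2) that by fastforce
  have "continuous_map mtopology euclideanreal (\<lambda>x. d x (p x))"
  proof (rule nonexpansive_imp_continuous_map_dist)
    show "dist (d x (p x)) (d y (p y)) \<le> d x y" if "x \<in> M" "y \<in> M" for x y
      using lip[OF that] lip[OF that(2,1)] commute[of x y] by (auto simp: dist_real_def)
  qed
  then have "compact ((\<lambda>x. d x (p x)) ` M)"
    using assms(1) image_compactin compactin_euclidean_iff
    unfolding compact_space_def topspace_mtopology by blast
  then obtain y where y: "y \<in> M" "\<And>z. z \<in> M \<Longrightarrow> d z (p z) \<le> d y (p y)"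
    using compact_attains_sup[of "(\<lambda>x. d x (p x)) ` M"] assms(3) A(2) by auto
  then show thesis
    using that[of y "p y"] p by metis
qed

lemma (in Metric_space) closed_invariant_eq_space:
  assumes "compact_space mtopology" and "closedin mtopology A" and "A \<noteq> {}"
    and cover: "M \<subseteq> (\<Union>f\<in>F. f ` M)"
    and contr: "\<And>f x y. f \<in> F \<Longrightarrow> x \<in> M \<Longrightarrow> y \<in> M \<Longrightarrow> x \<noteq> y \<Longrightarrow> d (f x) (f y) < d x y"
    and inv: "\<And>f. f \<in> F \<Longrightarrow> f ` A \<subseteq> A"
  shows "A = M"
proof -
  have "A \<subseteq> M"
    using assms(2) closedin_subset by fastforce
  obtain y a where y: "y \<in> M" "a \<in> A" and near: "\<And>b. b \<in> A \<Longrightarrow> d y a \<le> d y b"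
    and far: "\<And>z. z \<in> M \<Longrightarrow> \<exists>c\<in>A. d z c \<le> d y a"
    using compact_space_attains_Max_setdist[OF assms(1-3)] by metis
  obtain f z where z: "f \<in> F" "z \<in> M" "y = f z"
    using cover y(1) by blast
  obtain c where c: "c \<in> A" "d z c \<le> d y a"
    using far z(2) by blast
  have fc: "f c \<in> A"
    using inv z(1) c(1) by blast
  \<comment> \<open>Otherwise \<open>d y (f c) < d z c \<le> d y a \<le> d y (f c)\<close>, since
    \<open>y = f z\<close> and \<open>f c\<close> lies in \<open>A\<close>.\<close>
  have "z = c"
    using contr[of f z c] near[OF fc] z c \<open>A \<subseteq> M\<close> by fastforce
  then have "y \<in> A"
    using fc z(3) by simp
  \<comment> \<open>The maximal distance to \<open>A\<close> is thus 0, so every point of the space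
    coincides with a point of \<open>A\<close>.\<close>
  then have "d y a \<le> 0"
    using near[of y] y(1) by simp
  then have "z \<in> A" if "z \<in> M" for z
    using far[OF that] that \<open>A \<subseteq> M\<close> by (metis nonneg order_antisym order_trans subsetD zero)
  then show ?thesis
    using \<open>A \<subseteq> M\<close> by blast
qed

lemma map_semigroup_maps:
  assumes "\<sigma> \<in> map_semigroup N \<delta>" and "\<And>i. i \<in> {1..N} \<Longrightarrow> \<delta> i \<in> X \<rightarrow> X"
  shows "\<sigma> \<in> X \<rightarrow> X"
  using assms by induction auto

lemma orbit_set_self: "x \<in> orbit_set N \<delta> x"
  unfolding orbit_set_def using map_semigroup.ident[of N \<delta>] by (auto intro!: exI[of _ id])

lemma orbit_set_invariant:
  assumes "i \<in> {1..N}"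
  shows "\<delta> i ` orbit_set N \<delta> x \<subseteq> orbit_set N \<delta> x"
proof -
  have "\<delta> i \<circ> \<sigma> \<in> map_semigroup N \<delta>" if "\<sigma> \<in> map_semigroup N \<delta>" for \<sigma>
    by (intro map_semigroup.comp map_semigroup.gen assms that)
  then show ?thesis
    unfolding orbit_set_def by (auto simp del: atLeastAtMost_iff) (metis comp_apply)
qed

theorem proposition1p1p4:
  fixes X :: "'a set" and d :: "'a \<Rightarrow> 'a \<Rightarrow> real"
    and N :: nat and \<delta> :: "nat \<Rightarrow> 'a \<Rightarrow> 'a"
  assumes "Metric_space X d"
    and "compact_space (Metric_space.mtopology X d)"
    and "\<And>i. i \<in> {1..N} \<Longrightarrow> \<delta> i \<in> X \<rightarrow> X"
    and "(\<Union>i\<in>{1..N}. \<delta> i ` X) = X"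
    and "\<And>i x y. i \<in> {1..N} \<Longrightarrow> x \<in> X \<Longrightarrow> y \<in> X \<Longrightarrow> x \<noteq> y \<Longrightarrow> d (\<delta> i x) (\<delta> i y) < d x y"
  shows "minimal_system X d N \<delta>"
proof -
  interpret Metric_space X d by fact
  have cont: "continuous_map mtopology mtopology (\<delta> i)" if i: "i \<in> {1..N}" for i
  proof (rule nonexpansive_imp_continuous_map[OF Metric_space_axioms])
    \<comment> \<open>The strict bound handles distinct points; for \<open>x = y\<close> both
      distances are 0.\<close>
    show "d (\<delta> i x) (\<delta> i y) \<le> d x y" if "x \<in> X" "y \<in> X" for x y
      using assms(3)[OF i] assms(5)[OF i that] that by (cases "x = y") (auto simp: Pi_iff)
  qed (fact assms(3)[OF i])
  have "mtopology closure_of orbit_set N \<delta> x = X" if "x \<in> X" for x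
  proof (rule closed_invariant_eq_space[where F = "\<delta> ` {1..N}"])
    let ?A = "mtopology closure_of orbit_set N \<delta> x"
    \<comment> \<open>Lying in the carrier, the orbit is contained in its closure, which therefore
      contains \<open>x\<close>.\<close>
    have "orbit_set N \<delta> x \<subseteq> X"
      using map_semigroup_maps[of _ N \<delta> X] assms(3) that unfolding orbit_set_def by blast
    then show "?A \<noteq> {}"
      using closure_of_subset[of "orbit_set N \<delta> x" mtopology] orbit_set_self[of x N \<delta>] by auto
    show "f ` ?A \<subseteq> ?A" if f: "f \<in> \<delta> ` {1..N}" for f
    proof -
      obtain i where i: "i \<in> {1..N}" "f = \<delta> i"
        using f by blast
      \<comment> \<open>Continuity passes the invariance of the orbit on to its closure.\<close>
      have "\<delta> i ` ?A \<subseteq> mtopology closure_of (\<delta> i ` orbit_set N \<delta> x)"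
        by (rule continuous_map_image_closure_subset[OF cont[OF i(1)]])
      also have "\<dots> \<subseteq> ?A"
        by (rule closure_of_mono[OF orbit_set_invariant[OF i(1)]])
      finally show ?thesis
        using i(2) by simp
    qed
  qed (use assms in \<open>auto simp del: atLeastAtMost_iff\<close>)
  then show ?thesis
    unfolding minimal_system_def dynamical_system_def using assms(1) cont by blast
qed

end
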